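(* Let $1\le k\le n\le N$, let $\beta_0,\beta_1,\dots,\beta_{n-1}$ be arbitrary $n$ $\mathbb{F}_q$-linearly independent elements in $\mathbb{F}_{q^N}$, let $\mathcal{V}$ be the $(n,k)$ Gabidulin linear code over $\mathbb{F}_{q^N}$ determined by them, and let $\mathcal{B}$ be an arbitrary basis of $\mathbb{F}_{q^N}$ over $\mathbb{F}_q$. Then the $(N\times n,q^{Nk},d)$ Gabidulin code $\mathcal{M}_{\mathcal{B}}(\mathcal{V})$ induced from $\mathcal{V}$ with respect to $\mathcal{B}$ equals $$\mathcal{M}_{\mathcal{B}}(\mathcal{V})=\Big\{\big[L^\dag(\mathbf{V}\mathbf{A}(\beta_0)\mathbf{V}^{-1})^{\mathrm T}~L^\dag(\mathbf{V}\mathbf{A}(\beta_1)\mathbf{V}^{-1})^{\mathrm T}~\ldots~L^\dag(\mathbf{V}\mathbf{A}(\beta_{n-1})\mathbf{V}^{-1})^{\mathrm T}\big]: L^\dag(x)\in\mathcal{L}_N^\dag\Big\},$$ where $\mathbf{V}$ is the invertible matrix in $\mathbb{F}_q^{N\times N}$ satisfying $\mathcal{B}^{\mathrm T}=\mathbf{V}\mathcal{B}_\gamma^{\mathrm T}$ with $\mathcal{B}_\gamma=[\gamma^{N-1}~\gamma^{N-2}~\ldots~\gamma~1]$.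
   Context: $\mathbb{F}_q$ is the finite field with $q$ elements. Bases of $\mathbb{F}_{q^N}$ over $\mathbb{F}_q$ are written as row vectors in $\mathbb{F}_{q^N}^N$. Let $p(x)=p_0+p_1x+\cdots+p_{N-1}x^{N-1}+x^N$ be an arbitrary irreducible polynomial of degree $N$ over $\mathbb{F}_q$ and $\gamma\in\mathbb{F}_{q^N}$ a root of it. Let $\mathbf{A}(\gamma)\in\mathbb{F}_q^{N\times N}$ be the matrix whose first row is $[-p_{N-1}~-p_{N-2}~\ldots~-p_0]$ and whose $i$-th row, $2\le i\le N$, has a $1$ in column $i-1$ and zeros elsewhere. For an element $\sum_{i=0}^{N-1}a_i\gamma^i\in\mathbb{F}_{q^N}$ ($a_i\in\mathbb{F}_q$), put $\mathbf{A}(\sum_ia_i\gamma^i)=\sum_{i=0}^{N-1}a_i\mathbf{A}(\gamma)^i$. $\mathcal{L}_N^\dag=\{\mathbf{e}_0x+\mathbf{e}_1x^q+\cdots+\mathbf{e}_{k-1}x^{q^{k-1}}:\mathbf{e}_0,\dots,\mathbf{e}_{k-1}\in\mathbb{F}_q^N\}$, where $\mathbb{F}_q^N$ is the space of row vectors; such an $L^\dag(x)$ is evaluated at a matrix $\mathbf{X}\in\mathbb{F}_q^{N\times N}$ as the row vector $L^\dag(\mathbf{X})=\sum_{i=0}^{k-1}\mathbf{e}_i\mathbf{X}^{q^i}$. The $(n,k)$ Gabidulin linear code determined by $\beta_0,\dots,\beta_{n-1}$ is $\mathcal{V}=\{\mathbf{u}\mathbf{G}:\mathbf{u}\in\mathbb{F}_{q^N}^k\}$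 with $\mathbf{G}=[\beta_j^{q^i}]_{0\le i\le k-1,\,0\le j\le n-1}$. For $\mathbf{v}\in\mathbb{F}_{q^N}^n$, $\mathbf{M}_{\mathcal{B}}(\mathbf{v})\in\mathbb{F}_q^{N\times n}$ is the unique matrix with $\mathcal{B}\mathbf{M}_{\mathcal{B}}(\mathbf{v})=\mathbf{v}$, and $\mathcal{M}_{\mathcal{B}}(\mathcal{V})=\{\mathbf{M}_{\mathcal{B}}(\mathbf{v}):\mathbf{v}\in\mathcal{V}\}$. Its minimum rank distance is $d=n-k+1$. *)

theory Defs
  imports
    "Jordan_Normal_Form.Matrix"
    "Jordan_Normal_Form.Gauss_Jordan_Elimination"
    "Jordan_Normal_Form.DL_Rank"
    "HOL-Computational_Algebra.Polynomial"
    "HOL-Library.Cardinality"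
begin

text \<open>
  The base field is a type \<open>'q\<close>, the extension field a type \<open>'e\<close>, and the inclusion of the
  former in the latter is a field homomorphism \<open>h\<close>. Row and column vectors share the type
  of vectors; \<open>u \<cdot>\<^sub>r M\<close> is the product of the row vector \<open>u\<close> with \<open>M\<close>.
  Positions are counted from 0.
\<close>

definition row_mult :: "'a :: semiring_0 vec \<Rightarrow> 'a mat \<Rightarrow> 'a vec"  (infixl "\<cdot>\<^sub>r" 70)
  where "u \<cdot>\<^sub>r M = vec (dim_col M) (\<lambda>j. u \<bullet> col M j)"

definition ext_scale :: "('q :: field \<Rightarrow> 'e :: field) \<Rightarrow> 'q \<Rightarrow> 'e \<Rightarrow> 'e"
  where "ext_scale h a x = h a * x"

definition lin_indep_family :: "('q :: field \<Rightarrow> 'e :: field) \<Rightarrow> 'e vec \<Rightarrow> bool"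
  where "lin_indep_family h v \<longleftrightarrow>
    inj_on (($) v) {..<dim_vec v} \<and> \<not> module.dependent (ext_scale h) (set\<^sub>v v)"

definition ordered_basis :: "('q :: field \<Rightarrow> 'e :: field) \<Rightarrow> 'e vec \<Rightarrow> bool"
  where "ordered_basis h v \<longleftrightarrow>
    lin_indep_family h v \<and> module.span (ext_scale h) (set\<^sub>v v) = UNIV"

definition A_gen :: "'q :: field poly \<Rightarrow> 'q mat"
  where "A_gen p = mat (degree p) (degree p)
    (\<lambda>(i, j). if i = 0 then - coeff p (degree p - 1 - j) else if j = i - 1 then 1 else 0)"

definition power_coords :: "('q :: field \<Rightarrow> 'e :: field) \<Rightarrow> nat \<Rightarrow> 'e \<Rightarrow> 'e \<Rightarrow> 'q vec"
  where "power_coords h N \<gamma> \<alpha> =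
    (THE a. a \<in> carrier_vec N \<and> (\<Sum>i<N. h (a $ i) * \<gamma> ^ i) = \<alpha>)"

text \<open>
  Matrices of all sizes form one type, which has no zero, so sums of matrices and of vectors
  are formed entrywise.
\<close>

definition A_of :: "('q :: field \<Rightarrow> 'e :: field) \<Rightarrow> 'q poly \<Rightarrow> 'e \<Rightarrow> 'e \<Rightarrow> 'q mat"
  where "A_of h p \<gamma> \<alpha> = mat (degree p) (degree p)
    (\<lambda>rc. \<Sum>i<degree p. power_coords h (degree p) \<gamma> \<alpha> $ i * (A_gen p ^\<^sub>m i) $$ rc)"

text \<open>A polynomial \<open>e\<^sub>0 x + e\<^sub>1 x^q + \<dots> + e\<^bsub>k-1\<^esub> x^(q^(k-1))\<close>
  is given by the list of its coefficient vectors.\<close>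

definition Ldag :: "nat \<Rightarrow> nat \<Rightarrow> 'q vec list set"
  where "Ldag N k = {es. length es = k \<and> set es \<subseteq> carrier_vec N}"

definition Ldag_eval :: "nat \<Rightarrow> 'q :: field vec list \<Rightarrow> 'q mat \<Rightarrow> 'q vec"
  where "Ldag_eval q es X =
    vec (dim_col X) (\<lambda>c. \<Sum>i<length es. (es ! i \<cdot>\<^sub>r (X ^\<^sub>m (q ^ i))) $ c)"

definition gabidulin_gen :: "nat \<Rightarrow> nat \<Rightarrow> 'e :: field vec \<Rightarrow> 'e mat"
  where "gabidulin_gen q k \<beta> = mat k (dim_vec \<beta>) (\<lambda>(i, j). (\<beta> $ j) ^ (q ^ i))"

definition gabidulin_linear_code :: "nat \<Rightarrow> nat \<Rightarrow> 'e :: field vec \<Rightarrow> 'e vec set"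
  where "gabidulin_linear_code q k \<beta> = {u \<cdot>\<^sub>r gabidulin_gen q k \<beta> | u. u \<in> carrier_vec k}"

definition coord_mat :: "('q :: field \<Rightarrow> 'e :: field) \<Rightarrow> 'e vec \<Rightarrow> 'e vec \<Rightarrow> 'q mat"
  where "coord_mat h B v =
    (THE M. M \<in> carrier_mat (dim_vec B) (dim_vec v) \<and> B \<cdot>\<^sub>r map_mat h M = v)"

definition induced_code :: "('q :: field \<Rightarrow> 'e :: field) \<Rightarrow> 'e vec \<Rightarrow> 'e vec set \<Rightarrow> 'q mat set"
  where "induced_code h B C = coord_mat h B ` C"

definition min_rank_distance :: "nat \<Rightarrow> 'q :: field mat set \<Rightarrow> nat"
  where "min_rank_distance N C = Min {vec_space.rank N (X - Y) | X Y. X \<in> C \<and> Y \<in> C \<and> X \<noteq> Y}"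

text \<open>An \<open>(N \<times> n, M, d)\<close> rank-metric code.\<close>

definition rank_metric_code :: "nat \<Rightarrow> nat \<Rightarrow> nat \<Rightarrow> nat \<Rightarrow> 'q :: field mat set \<Rightarrow> bool"
  where "rank_metric_code N n M d C \<longleftrightarrow>
    C \<subseteq> carrier_mat N n \<and> card C = M \<and> min_rank_distance N C = d"

definition gamma_basis :: "nat \<Rightarrow> 'e :: field \<Rightarrow> 'e vec"
  where "gamma_basis N \<gamma> = vec N (\<lambda>i. \<gamma> ^ (N - 1 - i))"

definition basis_change :: "('q :: field \<Rightarrow> 'e :: field) \<Rightarrow> 'e vec \<Rightarrow> 'e vec \<Rightarrow> 'q mat"
  where "basis_change h B B' =
    (THE V. V \<in> carrier_mat (dim_vec B) (dim_vec B') \<and> invertible_mat V \<and>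
            B = map_mat h V *\<^sub>v B')"

text \<open>\<open>mat_inverse\<close> is option-valued; only its value on invertible matrices matters.\<close>

definition mat_inv :: "'q :: field mat \<Rightarrow> 'q mat"
  where "mat_inv V = the (mat_inverse V)"

end

theory Submission
  imports Defs "Berlekamp_Zassenhaus.Berlekamp_Type_Based"
begin

text \<open>
  Since \<open>\<^bold>A(\<alpha>)\<close> represents multiplication by \<open>\<alpha>\<close> in the basis of powers of \<open>\<gamma>\<close>, the
  conjugate \<open>X = V \<^bold>A(\<alpha>) V\<^sup>-\<^sup>1\<close> satisfies \<open>X B\<^sup>T = \<alpha> B\<^sup>T\<close>. Hence the row vector
  \<open>\<Sum> e\<^sub>i X^(q^i)\<close> holds the coordinates of \<open>\<Sum> u\<^sub>i \<alpha>^(q^i)\<close> with respect to \<open>B\<close>, where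
  \<open>u\<^sub>i = e\<^sub>i B\<^sup>T\<close>, and \<open>e\<^sub>i \<mapsto> u\<^sub>i\<close> is a bijection of \<open>L\<^sup>\<dagger>\<close> with the messages. For the
  distance, the kernel of the matrix of a nonzero codeword embeds into the roots of a nonzero
  polynomial of degree at most \<open>q^(k-1)\<close>, so its rank is at least \<open>n - k + 1\<close>; a
  pigeonhole argument gives a difference of codewords with only \<open>n - k + 1\<close> nonzero columns.
\<close>

section \<open>Rank of matrices over finite fields\<close>

text \<open>A vector of \<open>S\<close> outside \<open>span U\<close> could be adjoined to
  \<open>U\<close> without losing independence, against maximality.\<close>

lemma (in vec_space) span_maximal_lin_indpt:
  assumes "S \<subseteq> carrier_vec n" and "maximal U (\<lambda>T. T \<subseteq> S \<and> lin_indpt T)"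
  shows "span U = span S"
proof
  from assms(2) have U: "U \<subseteq> S" "lin_indpt U"
    unfolding maximal_def by auto
  show "span U \<subseteq> span S"
    using U(1) by (rule span_is_monotone)
  have "s \<in> span U" if "s \<in> S" for s
  proof (rule ccontr)
    assume s: "s \<notin> span U"
    have Uc: "U \<subseteq> carrier_vec n" using U(1) assms(1) by blast
    have sc: "s \<in> carrier_vec n" using that assms(1) by blast
    have "s \<notin> U" using s span_mem[OF Uc] by blast
    have "lin_indpt (U \<union> {s})"
      using lin_dep_iff_in_span[OF Uc U(2) sc \<open>s \<notin> U\<close>] s by blast
    moreover have "U \<union> {s} \<subseteq> S" using U(1) that by blast
    ultimately show False
      using assms(2) \<open>s \<notin> U\<close> unfolding maximal_def by blast
  qed
  then show "span S \<subseteq> span U"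
    using U(1) assms(1) by (meson span_is_submodule span_is_subset subsetI subset_trans)
qed

text \<open>A vector of the span is determined by its coefficients on \<open>S\<close>, and there
  are \<open>CARD('a) ^ card S\<close> choices of these.\<close>

lemma card_span_le:
  fixes S :: "'a :: {field, finite} vec set"
  assumes "S \<subseteq> carrier_vec n" and "finite S"
  shows "card (LinearCombinations.module.span class_ring (module_vec TYPE('a) n) S) \<le> CARD('a) ^ card S"
proof -
  interpret vec_space "TYPE('a)" n .
  have "span S \<subseteq> (\<lambda>a. lincomb a S) ` (S \<rightarrow>\<^sub>E UNIV)"
  proof
    fix v assume "v \<in> span S"
    then obtain a where a: "v = lincomb a S"
      using finite_span[OF assms(2)] assms(1) by auto
    \<comment> \<open>Restricting the coefficient function puts it into the finite set of
      extensional functions on \<open>S\<close>.\<close>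
    also have "\<dots> = lincomb (restrict a S) S"
      using assms by (intro lincomb_cong[OF refl]) auto
    finally show "v \<in> (\<lambda>a. lincomb a S) ` (S \<rightarrow>\<^sub>E UNIV)"
      by (intro image_eqI[where x = "restrict a S"]) auto
  qed
  then have "card (span S) \<le> card ((\<lambda>a. lincomb a S) ` (S \<rightarrow>\<^sub>E (UNIV :: 'a set)))"
    by (intro card_mono finite_imageI finite_PiE) (use assms in auto)
  also have "\<dots> \<le> card (S \<rightarrow>\<^sub>E (UNIV :: 'a set))"
    by (intro card_image_le finite_PiE) (use assms in auto)
  also have "\<dots> = CARD('a) ^ card S"
    by (simp add: card_PiE[OF assms(2)])
  finally show ?thesis .
qed

text \<open>The image of \<open>A\<close> is its column space, which is spanned by a maximal
  independent set of columns; such a set has as many elements as the rank.\<close>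

lemma card_image_mult_mat_vec_le:
  fixes A :: "'a :: {field, finite} mat"
  assumes "A \<in> carrier_mat n nc"
  shows "card ((*\<^sub>v) A ` carrier_vec nc) \<le> CARD('a) ^ vec_space.rank n A"
proof -
  interpret vec_space "TYPE('a)" n .
  have cols: "set (cols A) \<subseteq> carrier_vec n"
    using cols_dim assms by blast
  obtain S where S: "finite S" "maximal S (\<lambda>T. T \<subseteq> set (cols A) \<and> lin_indpt T)"
    using maximal_exists_superset[of "set (cols A)" "\<lambda>T. T \<subseteq> set (cols A) \<and> lin_indpt T" "{}"]
    by (auto simp: lin_dep_def)
  have "(*\<^sub>v) A ` carrier_vec nc = span S"
    using span_maximal_lin_indpt[OF cols S(2)] col_space_eq[OF assms] assms
    by (auto simp: col_space_def)
  moreover have "card (span S) \<le> CARD('a) ^ card S"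
    by (rule card_span_le) (use S cols in \<open>auto simp: maximal_def\<close>)
  ultimately show ?thesis
    using rank_card_indpt[OF assms S(2)] by simp
qed

text \<open>Counting form of rank-nullity: the domain splits into fibres over the image, and
  subtracting a fixed element of a fibre embeds that fibre into the kernel.\<close>

lemma card_carrier_vec_le_rank_kernel:
  fixes A :: "'a :: {field, finite} mat"
  assumes A: "A \<in> carrier_mat n nc"
  shows "CARD('a) ^ nc \<le>
    CARD('a) ^ vec_space.rank n A * card {x \<in> carrier_vec nc. A *\<^sub>v x = 0\<^sub>v n}"
    (is "_ \<le> _ * card ?K")
proof -
  let ?C = "carrier_vec nc :: 'a vec set"
  have fibre: "card {x \<in> ?C. A *\<^sub>v x = y} \<le> card ?K" if y: "y \<in> (*\<^sub>v) A ` ?C" for y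
  proof -
    obtain z where z: "z \<in> ?C" "y = A *\<^sub>v z" using y by blast
    show ?thesis
    proof (rule card_inj_on_le[where f = "\<lambda>x. x - z"])
      show "inj_on (\<lambda>x. x - z) {x \<in> ?C. A *\<^sub>v x = y}"
      proof (rule inj_onI)
        fix x x' assume *: "x \<in> {x \<in> ?C. A *\<^sub>v x = y}" "x' \<in> {x \<in> ?C. A *\<^sub>v x = y}" "x - z = x' - z"
        have "x $ i = x' $ i" if "i < nc" for i
          using arg_cong[OF *(3), of "\<lambda>v. v $ i"] that z(1) by simp
        then show "x = x'" using *(1,2) by (intro eq_vecI) auto
      qed
      show "(\<lambda>x. x - z) ` {x \<in> ?C. A *\<^sub>v x = y} \<subseteq> ?K"
        using A z by (auto simp: mult_minus_distrib_mat_vec)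
      show "finite ?K" by simp
    qed
  qed
  have "CARD('a) ^ nc = card ?C"
    by (simp add: card_carrier_vec)
  also have "\<dots> = (\<Sum>y\<in>(*\<^sub>v) A ` ?C. card {x \<in> ?C. A *\<^sub>v x = y})"
    using sum.image_gen[of ?C "\<lambda>_. 1 :: nat" "(*\<^sub>v) A"] by simp
  also have "\<dots> \<le> card ((*\<^sub>v) A ` ?C) * card ?K"
    using sum_bounded_above[of "(*\<^sub>v) A ` ?C" "\<lambda>y. card {x \<in> ?C. A *\<^sub>v x = y}" "card ?K"] fibre
    by simp
  also have "\<dots> \<le> CARD('a) ^ vec_space.rank n A * card ?K"
    by (intro mult_right_mono card_image_mult_mat_vec_le A) simp
  finally show ?thesis .
qed

text \<open>An independent set of columns cannot contain the zero vector, so all its members have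
  their positions in \<open>J\<close>.\<close>

lemma rank_le_card_nonzero_cols:
  fixes A :: "'a :: field mat"
  assumes A: "A \<in> carrier_mat n nc" and J: "\<And>j. j < nc \<Longrightarrow> j \<notin> J \<Longrightarrow> col A j = 0\<^sub>v n" and "finite J"
  shows "vec_space.rank n A \<le> card J"
proof -
  interpret vec_space "TYPE('a)" n .
  obtain S where S: "finite S" "maximal S (\<lambda>T. T \<subseteq> set (cols A) \<and> lin_indpt T)"
    using maximal_exists_superset[of "set (cols A)" "\<lambda>T. T \<subseteq> set (cols A) \<and> lin_indpt T" "{}"]
    by (auto simp: lin_dep_def)
  have S': "S \<subseteq> set (cols A)" "lin_indpt S" using S(2) by (auto simp: maximal_def)
  have "0\<^sub>v n \<notin> S"
    using S' cols_dim[of A] A vs_zero_lin_dep[of S] by auto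
  have "S \<subseteq> col A ` J"
  proof
    fix s assume "s \<in> S"
    then obtain j where j: "j < nc" "s = col A j"
      using S'(1) A by (auto simp: cols_def)
    then have "j \<in> J" using J \<open>s \<in> S\<close> \<open>0\<^sub>v n \<notin> S\<close> by metis
    then show "s \<in> col A ` J" using j(2) by simp
  qed
  then have "card S \<le> card J"
    using \<open>finite J\<close> by (rule surj_card_le[rotated])
  then show ?thesis
    using rank_card_indpt[OF A S(2)] by simp
qed

section \<open>Linearized polynomials\<close>

text \<open>Multiplication by a nonzero \<open>x\<close> permutes the nonzero elements; comparing
  the products over them shows that \<open>x\<close> to the power \<open>CARD('a) - 1\<close> is
  1.\<close>

lemma finite_field_power_card:
  fixes x :: "'a :: {field, finite}"
  shows "x ^ CARD('a) = x"
proof (cases "x = 0")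
  case True
  then show ?thesis by simp
next
  case False
  let ?S = "UNIV - {0 :: 'a}"
  have "bij_betw ((*) x) ?S ?S"
    by (rule bij_betwI[where g = "(*) (inverse x)"]) (use False in \<open>auto simp: field_simps\<close>)
  then have "(\<Prod>y\<in>?S. x * y) = \<Prod>?S"
    by (rule prod.reindex_bij_betw)
  then have "x ^ card ?S * \<Prod>?S = \<Prod>?S"
    by (simp add: prod.distrib)
  moreover have "\<Prod>?S \<noteq> 0"
    by simp
  ultimately have "x ^ card ?S = 1"
    by simp
  moreover have "CARD('a) = Suc (card ?S)"
    by (simp add: card_Diff_singleton)
  ultimately show ?thesis
    by (metis power_Suc mult.right_neutral)
qed

locale finite_field_extension = field_hom h
  for h :: "'q :: {field, finite} \<Rightarrow> 'e :: {field, finite}"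
begin

lemma card_base_gt_1: "1 < CARD('q)"
  using card_mono[of UNIV "{0, 1 :: 'q}"] by simp

text \<open>
  Both sides of \<open>(X + 1)^q = X^q + 1\<close> have the same leading coefficient and agree on the
  \<open>q\<close> elements of the base field, so the inner binomial coefficients vanish.
\<close>

lemma of_nat_choose_card_eq_0:
  assumes "0 < i" and "i < CARD('q)"
  shows "of_nat (CARD('q) choose i) = (0 :: 'e)"
proof -
  have "[:1, 1 :: 'q:] ^ CARD('q) = Polynomial.monom 1 CARD('q) + 1"
  proof (rule poly_eqI_degree_lead_coeff[where A = UNIV and n = "CARD('q)"])
    show "poly.coeff ([:1, 1 :: 'q:] ^ CARD('q)) CARD('q) = poly.coeff (Polynomial.monom 1 CARD('q) + 1) CARD('q)"
      using card_base_gt_1 by (subst coeff_linear_poly_power) simp_all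
    show "degree ([:1, 1 :: 'q:] ^ CARD('q)) \<le> CARD('q)"
      by (simp add: degree_power_eq)
    show "degree (Polynomial.monom 1 CARD('q) + 1 :: 'q poly) \<le> CARD('q)"
      by (intro degree_add_le degree_monom_le) simp
    show "poly ([:1, 1 :: 'q:] ^ CARD('q)) z = poly (Polynomial.monom 1 CARD('q) + 1) z" for z
      by (simp add: poly_monom finite_field_power_card)
  qed simp
  from arg_cong[OF this, of "\<lambda>f. coeff f i"] have "of_nat (CARD('q) choose i) = (0 :: 'q)"
    using assms by (subst (asm) coeff_linear_poly_power) simp_all
  from arg_cong[OF this, of h] show ?thesis
    by (simp add: hom_distribs)
qed

text \<open>Only the two extreme terms of the binomial expansion survive. This is the additive half
  of the linearity of the Frobenius map over the base field.\<close>

lemma power_card_add: "(a + b) ^ CARD('q) = a ^ CARD('q) + b ^ CARD('q)" for a b :: 'e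
proof -
  have "(a + b) ^ CARD('q) = (\<Sum>i\<le>CARD('q). of_nat (CARD('q) choose i) * a ^ i * b ^ (CARD('q) - i))"
    by (rule binomial_ring)
  also have "\<dots> = (\<Sum>i\<in>{0, CARD('q)}. of_nat (CARD('q) choose i) * a ^ i * b ^ (CARD('q) - i))"
  proof (rule sum.mono_neutral_right)
    show "\<forall>i\<in>{..CARD('q)} - {0, CARD('q)}.
        of_nat (CARD('q) choose i) * a ^ i * b ^ (CARD('q) - i) = 0"
    proof
      fix i assume "i \<in> {..CARD('q)} - {0, CARD('q)}"
      then have "0 < i" "i < CARD('q)"
        using le_neq_implies_less[of i "CARD('q)"] by simp_all
      from of_nat_choose_card_eq_0[OF this]
      show "of_nat (CARD('q) choose i) * a ^ i * b ^ (CARD('q) - i) = 0"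
        by simp
    qed
  qed simp_all
  also have "\<dots> = a ^ CARD('q) + b ^ CARD('q)"
    using card_base_gt_1 by simp
  finally show ?thesis .
qed

lemma power_card_power_add: "(a + b) ^ (CARD('q) ^ i) = a ^ (CARD('q) ^ i) + b ^ (CARD('q) ^ i)" for a b :: 'e
proof (induction i arbitrary: a b)
  case (Suc i)
  show ?case
    by (simp only: power_Suc power_mult power_card_add Suc.IH)
qed simp

lemma power_card_power_hom: "h x ^ (CARD('q) ^ i) = h x"
proof (induction i)
  case (Suc i)
  have "h x ^ CARD('q) = h x"
    by (simp add: finite_field_power_card flip: hom_power)
  then show ?case
    by (simp only: power_Suc power_mult Suc.IH)
qed simp

text \<open>This is the linearized polynomial with coefficient vector \<open>u\<close>. It is linear
  over the base field, and its values at the entries of \<open>\<beta>\<close> form the codeword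
  with message \<open>u\<close>.\<close>

definition lin_eval :: "'e vec \<Rightarrow> 'e \<Rightarrow> 'e"
  where "lin_eval u x = (\<Sum>i<dim_vec u. u $ i * x ^ (CARD('q) ^ i))"

lemma lin_eval_0 [simp]: "lin_eval u 0 = 0"
  by (simp add: lin_eval_def)

lemma lin_eval_add: "lin_eval u (x + y) = lin_eval u x + lin_eval u y"
  by (simp add: lin_eval_def power_card_power_add algebra_simps sum.distrib)

lemma lin_eval_hom_mult: "lin_eval u (h c * x) = h c * lin_eval u x"
  by (simp add: lin_eval_def power_mult_distrib power_card_power_hom sum_distrib_left mult_ac)

lemma lin_eval_sum: "lin_eval u (\<Sum>j\<in>J. h (c j) * b j) = (\<Sum>j\<in>J. h (c j) * lin_eval u (b j))"
  by (induction J rule: infinite_finite_induct) (simp_all add: lin_eval_add lin_eval_hom_mult)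

lemma lin_eval_minus:
  "dim_vec u = dim_vec u' \<Longrightarrow> lin_eval (u - u') x = lin_eval u x - lin_eval u' x"
  by (simp add: lin_eval_def algebra_simps sum_subtractf)

text \<open>The exponents are distinct powers of \<open>CARD('q)\<close>, so every entry of
  \<open>u\<close> really is a coefficient of the polynomial \<open>P\<close>, which is therefore
  nonzero and has at most \<open>degree P\<close> roots.\<close>

lemma card_roots_lin_eval:
  assumes u: "u \<in> carrier_vec k" "u \<noteq> 0\<^sub>v k"
  shows "card {x. lin_eval u x = 0} \<le> CARD('q) ^ (k - 1)"
proof -
  define P where "P = (\<Sum>i<k. Polynomial.monom (u $ i) (CARD('q) ^ i))"
  have poly: "poly P x = lin_eval u x" for x
    using u(1) by (simp add: P_def lin_eval_def poly_sum poly_monom)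
  have inj: "CARD('q) ^ i = CARD('q) ^ j \<longleftrightarrow> i = j" for i j
    using card_base_gt_1 by simp
  have coeff: "poly.coeff P (CARD('q) ^ i) = u $ i" if "i < k" for i
    using that by (simp add: P_def coeff_sum inj if_distrib cong: if_cong)
  obtain i where "i < k" "u $ i \<noteq> 0"
    using u by (metis carrier_vecD eq_vecI index_zero_vec)
  then have "P \<noteq> 0"
    using coeff by fastforce
  then have "card {x. poly P x = 0} \<le> degree P"
    by (rule card_poly_roots_bound)
  also have "degree P \<le> CARD('q) ^ (k - 1)"
    unfolding P_def
  proof (rule degree_sum_le)
    fix i assume "i \<in> {..<k}"
    then have "CARD('q) ^ i \<le> CARD('q) ^ (k - 1)"
      using card_base_gt_1 by (intro power_increasing) auto
    then show "degree (Polynomial.monom (u $ i) (CARD('q) ^ i)) \<le> CARD('q) ^ (k - 1)"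
      using degree_monom_le order_trans by blast
  qed simp
  finally show ?thesis
    by (simp add: poly)
qed

section \<open>Coordinates and multiplication matrices\<close>

text \<open>For a basis \<open>v\<close> this is the inverse of the coordinate map; for the family
  \<open>\<beta>\<close> its injectivity expresses independence.\<close>

definition comb :: "'e vec \<Rightarrow> 'q vec \<Rightarrow> 'e"
  where "comb v x = map_vec h x \<bullet> v"

lemma comb_eq_sum: "comb v x = (\<Sum>i<dim_vec v. h (x $ i) * v $ i)" if "dim_vec x = dim_vec v"
  using that by (simp add: comb_def scalar_prod_def atLeast0LessThan)

lemma comb_minus:
  "dim_vec x = dim_vec v \<Longrightarrow> dim_vec y = dim_vec v \<Longrightarrow> comb v (x - y) = comb v x - comb v y"
  by (simp add: comb_eq_sum hom_minus algebra_simps sum_subtractf)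

lemma comb_vec_sum:
  "comb v (vec (dim_vec v) (\<lambda>c. \<Sum>i\<in>I. f i c)) = (\<Sum>i\<in>I. comb v (vec (dim_vec v) (f i)))"
  by (simp add: comb_eq_sum hom_sum sum_distrib_right sum.swap[of _ I])

lemma inj_on_comb_iff:
  "inj_on (comb v) (carrier_vec (dim_vec v)) \<longleftrightarrow>
    (\<forall>x\<in>carrier_vec (dim_vec v). comb v x = 0 \<longrightarrow> x = 0\<^sub>v (dim_vec v))" (is "?l \<longleftrightarrow> ?r")
proof
  assume inj: ?l
  have "comb v (0\<^sub>v (dim_vec v)) = 0"
    by (simp add: comb_eq_sum)
  then show ?r
    using inj_onD[OF inj, of _ "0\<^sub>v (dim_vec v)"] by simp
next
  assume r: ?r
  show ?l
  proof (rule inj_onI)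
    fix x y assume *: "x \<in> carrier_vec (dim_vec v)" "y \<in> carrier_vec (dim_vec v)" "comb v x = comb v y"
    then have "x - y = 0\<^sub>v (dim_vec v)"
      using r comb_minus[of x v y] by auto
    then have "(x - y) $ i = 0" if "i < dim_vec v" for i
      using that by simp
    then show "x = y"
      using * by (intro eq_vecI) auto
  qed
qed

lemma module_ext_scale: "Modules.module (ext_scale h)"
  by unfold_locales (simp_all add: ext_scale_def hom_distribs algebra_simps)

text \<open>Passes from independence of a set to that of an indexed family: the entries being
  distinct, coefficients attached to positions can be carried over to elements.\<close>

lemma inj_on_comb_if_lin_indep_family:
  assumes "lin_indep_family h v"
  shows "inj_on (comb v) (carrier_vec (dim_vec v))"
  unfolding inj_on_comb_iff
proof (intro ballI impI)
  interpret Modules.module "ext_scale h"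
    by (rule module_ext_scale)
  let ?I = "{..<dim_vec v}"
  fix x :: "'q vec" assume x: "x \<in> carrier_vec (dim_vec v)" "comb v x = 0"
  from assms have inj: "inj_on (($) v) ?I" and indep: "independent (set\<^sub>v v)"
    by (auto simp: lin_indep_family_def)
  define f where "f w = x $ the_inv_into ?I (($) v) w" for w
  have f: "f (v $ i) = x $ i" if "i \<in> ?I" for i
    using the_inv_into_f_f[OF inj that] by (simp add: f_def)
  have "(\<Sum>w\<in>set\<^sub>v v. ext_scale h (f w) w) = (\<Sum>i\<in>?I. h (x $ i) * v $ i)"
    unfolding vec_set_def using inj f by (simp add: sum.reindex ext_scale_def)
  also have "\<dots> = 0"
    using x by (simp add: comb_eq_sum)
  finally have sum0: "(\<Sum>w\<in>set\<^sub>v v. ext_scale h (f w) w) = 0" .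
  have "x $ i = 0" if "i \<in> ?I" for i
    using independentD[OF indep _ order_refl sum0, of "v $ i"] that f[OF that]
    by (auto simp: vec_set_def)
  then show "x = 0\<^sub>v (dim_vec v)"
    using x(1) by (intro eq_vecI) auto
qed

text \<open>Counting replaces a dimension argument: an injection between finite sets of equal size
  is onto.\<close>

lemma bij_betw_comb:
  assumes "CARD('e) = CARD('q) ^ dim_vec v" and "inj_on (comb v) (carrier_vec (dim_vec v))"
  shows "bij_betw (comb v) (carrier_vec (dim_vec v)) UNIV"
proof -
  have "card (comb v ` carrier_vec (dim_vec v)) = CARD('e)"
    using assms by (simp add: card_image card_carrier_vec)
  then have "comb v ` carrier_vec (dim_vec v) = UNIV"
    by (intro card_subset_eq) auto
  then show ?thesis
    using assms(2) by (simp add: bij_betw_def)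
qed

section \<open>Independence of the powers of \<gamma>\<close>

lemma degree_le_if_common_root:
  assumes "irreducible p" and p0: "poly (map_poly h p) \<gamma> = 0"
    and "r \<noteq> 0" and "poly (map_poly h r) \<gamma> = 0"
  shows "degree p \<le> degree r"
proof -
  have const: "poly (map_poly h [:c:]) \<gamma> = h c" for c
    by (simp add: map_poly_pCons hom_distribs)
  interpret mp: map_poly_idom_hom h ..
  let ?Q = "\<lambda>m. m \<noteq> 0 \<and> poly (map_poly h m) \<gamma> = 0"
  \<comment> \<open>Up to a unit, \<open>m\<close> is the minimal polynomial of \<gamma>. The
    remainder of \<open>p\<close> modulo \<open>m\<close> vanishes at \<gamma> and so must be zero;
    irreducibility then makes the cofactor of \<open>m\<close> in \<open>p\<close> a unit.\<close>
  obtain m where m: "?Q m" and least: "\<And>s. ?Q s \<Longrightarrow> degree m \<le> degree s"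
    using ex_has_least_nat[of ?Q r degree] assms by blast
  have "p mod m = p - p div m * m"
    by (simp add: minus_div_mult_eq_mod)
  then have "poly (map_poly h (p mod m)) \<gamma> = 0"
    using p0 m by (simp add: hom_distribs)
  then have "p mod m = 0"
    using least[of "p mod m"] degree_mod_less[of m p] m by fastforce
  then have "m dvd p"
    by (simp add: mod_eq_0_iff_dvd)
  then obtain s where s: "p = m * s"
    by (rule dvdE)
  have "\<not> m dvd 1"
  proof
    assume "m dvd 1"
    then obtain c where "m = [:c:]"
      using degree_eq_zeroE is_unit_iff_degree[of m] m by blast
    then show False
      using m const by auto
  qed
  then have "s dvd 1"
    using assms(1) s irreducibleD by blast
  moreover have "s \<noteq> 0" using assms(1) s by auto
  ultimately have "degree p = degree m"
    using s m by (simp add: degree_mult_eq is_unit_iff_degree)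
  then show ?thesis
    using least[of r] assms by simp
qed

text \<open>A vanishing combination is a polynomial of degree less than \<open>degree p\<close> with
  root \<gamma>, hence zero.\<close>

lemma powers_independent:
  assumes "irreducible p" and "poly (map_poly h p) \<gamma> = 0"
    and sum0: "(\<Sum>i<degree p. h (a i) * \<gamma> ^ i) = 0" and "i < degree p"
  shows "a i = 0"
proof -
  interpret mp: map_poly_idom_hom h ..
  define r where "r = (\<Sum>i<degree p. Polynomial.monom (a i) i)"
  have coeff: "poly.coeff r j = (if j < degree p then a j else 0)" for j
    by (simp add: r_def coeff_sum if_distrib cong: if_cong)
  have "poly (map_poly h r) \<gamma> = 0"
    using sum0 by (simp add: r_def hom_distribs poly_sum poly_monom)
  moreover have "degree r < degree p"
    using assms(4) coeff by (intro degree_lessI) auto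
  ultimately have "r = 0"
    using degree_le_if_common_root[OF assms(1,2), of r] by fastforce
  then show ?thesis
    using coeff[of i] assms(4) by simp
qed

section \<open>Matrices over the base field with an eigenvector over the extension\<close>

lemma map_mat_mult_vec_index:
  assumes "A \<in> carrier_mat m N" and "w \<in> carrier_vec N" and "r < m"
  shows "(map_mat h A *\<^sub>v w) $ r = (\<Sum>c<N. h (A $$ (r, c)) * w $ c)"
  using assms by (simp add: scalar_prod_def atLeast0LessThan)

lemma map_mat_mult_mult_vec:
  assumes "A \<in> carrier_mat N N" and "M \<in> carrier_mat N N" and "w \<in> carrier_vec N"
  shows "map_mat h (A * M) *\<^sub>v w = map_mat h A *\<^sub>v (map_mat h M *\<^sub>v w)"
  using assms by (simp add: mat_hom_mult[of _ N N] assoc_mult_mat_vec[of _ N N _ N])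

text \<open>Transposition moves \<open>X\<close> from the row \<open>e\<close> to the eigenvector
  \<open>v\<close>: multiplying coordinate rows by \<open>X\<close> from the right is multiplication
  by \<alpha> on the elements they represent.\<close>

lemma comb_row_mult:
  assumes X: "X \<in> carrier_mat N N" and v: "v \<in> carrier_vec N" and e: "e \<in> carrier_vec N"
    and eigen: "map_mat h X *\<^sub>v v = \<alpha> \<cdot>\<^sub>v v"
  shows "comb v (e \<cdot>\<^sub>r X) = \<alpha> * comb v e"
proof -
  have "e \<cdot>\<^sub>r X = transpose_mat X *\<^sub>v e"
    using X e by (intro eq_vecI) (auto simp: row_mult_def comm_scalar_prod[of e N])
  then have "map_vec h (e \<cdot>\<^sub>r X) = transpose_mat (map_mat h X) *\<^sub>v map_vec h e"
    using X e by (simp add: mult_mat_vec_hom[of _ N N] map_mat_transpose)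
  then have "comb v (e \<cdot>\<^sub>r X) = map_vec h e \<bullet> (map_mat h X *\<^sub>v v)"
    using X e v by (simp add: comb_def transpose_vec_mult_scalar[of _ N N])
  also have "\<dots> = \<alpha> * comb v e"
    using e v by (simp add: eigen comb_def)
  finally show ?thesis .
qed

lemma eigen_pow:
  assumes X: "X \<in> carrier_mat N N" and v: "v \<in> carrier_vec N"
    and eigen: "map_mat h X *\<^sub>v v = \<alpha> \<cdot>\<^sub>v v"
  shows "map_mat h (X ^\<^sub>m m) *\<^sub>v v = \<alpha> ^ m \<cdot>\<^sub>v v"
proof (induction m)
  case 0
  then show ?case
    using X v by (simp add: mat_hom_one)
next
  case (Suc m)
  have Xm: "X ^\<^sub>m m \<in> carrier_mat N N"
    using X by simp
  have "map_mat h (X ^\<^sub>m Suc m) *\<^sub>v v = map_mat h (X ^\<^sub>m m) *\<^sub>v (map_mat h X *\<^sub>v v)"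
    using map_mat_mult_mult_vec[OF Xm X v] by simp
  also have "\<dots> = \<alpha> \<cdot>\<^sub>v (map_mat h (X ^\<^sub>m m) *\<^sub>v v)"
    using Xm v by (simp add: eigen mult_mat_vec[of _ N N])
  finally show ?case
    by (simp add: Suc.IH smult_smult_assoc)
qed

text \<open>The powers of \<open>X\<close> have the same eigenvector, with the powers of \<alpha> as
  eigenvalues, so each term of the vector polynomial represents one term of the linearized
  polynomial.\<close>

lemma comb_Ldag_eval:
  assumes X: "X \<in> carrier_mat N N" and v: "v \<in> carrier_vec N"
    and eigen: "map_mat h X *\<^sub>v v = \<alpha> \<cdot>\<^sub>v v" and L: "L \<in> Ldag N k"
  shows "comb v (Ldag_eval CARD('q) L X) = lin_eval (vec k (\<lambda>i. comb v (L ! i))) \<alpha>"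
proof -
  have len: "length L = k" and e: "\<And>i. i < k \<Longrightarrow> L ! i \<in> carrier_vec N"
    using L by (auto simp: Ldag_def)
  have "comb v (Ldag_eval CARD('q) L X) =
      comb v (vec (dim_vec v) (\<lambda>c. \<Sum>i<k. (L ! i \<cdot>\<^sub>r (X ^\<^sub>m (CARD('q) ^ i))) $ c))"
    using X v len by (simp add: Ldag_eval_def)
  also have "\<dots> =
      (\<Sum>i<k. comb v (vec (dim_vec v) (\<lambda>c. (L ! i \<cdot>\<^sub>r (X ^\<^sub>m (CARD('q) ^ i))) $ c)))"
    by (rule comb_vec_sum)
  also have "\<dots> = (\<Sum>i<k. comb v (L ! i) * \<alpha> ^ (CARD('q) ^ i))"
  proof (rule sum.cong[OF refl])
    fix i assume "i \<in> {..<k}"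
    then have i: "L ! i \<in> carrier_vec N" using e by simp
    have Xm: "X ^\<^sub>m (CARD('q) ^ i) \<in> carrier_mat N N"
      using X by simp
    have "vec (dim_vec v) (\<lambda>c. (L ! i \<cdot>\<^sub>r (X ^\<^sub>m (CARD('q) ^ i))) $ c) = L ! i \<cdot>\<^sub>r (X ^\<^sub>m (CARD('q) ^ i))"
      using v Xm by (intro eq_vecI) (auto simp: row_mult_def)
    then show "comb v (vec (dim_vec v) (\<lambda>c. (L ! i \<cdot>\<^sub>r (X ^\<^sub>m (CARD('q) ^ i))) $ c)) =
        comb v (L ! i) * \<alpha> ^ (CARD('q) ^ i)"
      using comb_row_mult[OF Xm v i eigen_pow[OF X v eigen]] by (simp add: mult.commute)
  qed
  finally show ?thesis
    by (simp add: lin_eval_def)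
qed

section \<open>Change of basis\<close>

lemma base_change_exists:
  assumes "dim_vec w = N" and "dim_vec v = N" and surj: "comb w ` carrier_vec N = UNIV"
  shows "\<exists>M\<in>carrier_mat N N. map_mat h M *\<^sub>v w = v"
proof -
  have "\<forall>i. \<exists>x\<in>carrier_vec N. comb w x = v $ i"
    using surj by (metis UNIV_I imageE)
  then obtain x where x: "\<And>i. x i \<in> carrier_vec N" "\<And>i. comb w (x i) = v $ i"
    by metis
  \<comment> \<open>Row \<open>i\<close> consists of coordinates of \<open>v $ i\<close> with
    respect to \<open>w\<close>.\<close>
  have "map_mat h (mat_of_rows N (map x [0..<N])) *\<^sub>v w = v"
  proof (rule eq_vecI)
    fix i assume i: "i < dim_vec v"
    then have "row (map_mat h (mat_of_rows N (map x [0..<N]))) i = map_vec h (x i)"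
      using x(1)[of i] assms(2) by (intro eq_vecI) (auto simp: mat_of_rows_def)
    then show "(map_mat h (mat_of_rows N (map x [0..<N])) *\<^sub>v w) $ i = v $ i"
      using i x(2)[of i] assms(2) by (simp add: comb_def)
  qed (use assms in simp)
  moreover have "mat_of_rows N (map x [0..<N]) \<in> carrier_mat N N"
    using mat_of_rows_carrier(1)[of N "map x [0..<N]"] by simp
  ultimately show ?thesis
    by blast
qed

lemma base_change_unique:
  assumes w: "dim_vec w = N" and inj: "inj_on (comb w) (carrier_vec N)"
    and M: "M \<in> carrier_mat N N" "M' \<in> carrier_mat N N"
    and eq: "map_mat h M *\<^sub>v w = map_mat h M' *\<^sub>v w"
  shows "M = M'"
proof (rule eq_rowI)
  fix i assume "i < dim_row M'"
  then have i: "i < N" using M by simp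
  have row: "row (map_mat h A) i = map_vec h (row A i)" if "A \<in> carrier_mat N N" for A
    using that i by (intro eq_vecI) auto
  have "comb w (row M i) = comb w (row M' i)"
    using arg_cong[OF eq, of "\<lambda>u. u $ i"] i M by (simp add: comb_def row)
  then show "row M i = row M' i"
    using M i by (intro inj_onD[OF inj]) auto
qed (use M in auto)

text \<open>Shows that the description in \<open>basis_change\<close> has exactly one solution and
  that \<open>mat_inverse\<close> succeeds on it, so that both constants have their intended
  values.\<close>

lemma basis_change_properties:
  fixes B G :: "'e vec"
  assumes B: "dim_vec B = N" and G: "dim_vec G = N"
    and bij: "bij_betw (comb B) (carrier_vec N) UNIV" "bij_betw (comb G) (carrier_vec N) UNIV"
  defines "V \<equiv> basis_change h B G"
  shows "V \<in> carrier_mat N N" and "mat_inv V \<in> carrier_mat N N"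
    and "map_mat h V *\<^sub>v G = B" and "map_mat h (mat_inv V) *\<^sub>v B = G"
proof -
  have vecs: "B \<in> carrier_vec N" "G \<in> carrier_vec N"
    using B G by (auto intro: carrier_vecI)
  have inj: "inj_on (comb B) (carrier_vec N)" "inj_on (comb G) (carrier_vec N)"
    using bij by (auto simp: bij_betw_def)
  obtain U where U: "U \<in> carrier_mat N N" "map_mat h U *\<^sub>v G = B"
    using base_change_exists[OF G B] bij(2) by (auto simp: bij_betw_def)
  obtain W where W: "W \<in> carrier_mat N N" "map_mat h W *\<^sub>v B = G"
    using base_change_exists[OF B G] bij(1) by (auto simp: bij_betw_def)
  \<comment> \<open>\<open>W\<close> takes \<open>B\<close> to \<open>G\<close> and \<open>U\<close>
    takes it back; uniqueness of the matrix of a base change then identifies the product.\<close>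
  have "map_mat h (U * W) *\<^sub>v B = map_mat h (1\<^sub>m N) *\<^sub>v B"
    using U W vecs by (simp add: map_mat_mult_mult_vec mat_hom_one)
  then have UW: "U * W = 1\<^sub>m N"
    using base_change_unique[OF B inj(1)] U W by simp
  then have WU: "W * U = 1\<^sub>m N"
    using mat_mult_left_right_inverse U W by blast
  have inv: "invertible_mat U"
    using U W UW WU by (auto simp: invertible_mat_def inverts_mat_def)
  have "V = U"
    unfolding V_def basis_change_def
    by (rule the_equality) (use U inv B G base_change_unique[OF G inj(2)] in auto)
  then show "V \<in> carrier_mat N N" "map_mat h V *\<^sub>v G = B"
    using U by auto
  \<comment> \<open>Being a unit of the matrix ring excludes the result \<open>None\<close>.\<close>
  have "U \<in> Units (ring_mat TYPE('q) N ())"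
    using U W UW WU by (auto simp: Units_def ring_mat_simps)
  then have "mat_inverse U \<noteq> None"
    using mat_inverse(1)[OF U(1), where b = "()"] by blast
  then obtain W' where W': "mat_inverse U = Some W'"
    by blast
  from mat_inverse(2)[OF U(1) this] have UW': "W' * U = 1\<^sub>m N" "W' \<in> carrier_mat N N"
    by auto
  have V: "mat_inv V = W'"
    using \<open>V = U\<close> W' by (simp add: mat_inv_def)
  then show "mat_inv V \<in> carrier_mat N N"
    using UW' by simp
  have "map_mat h W' *\<^sub>v B = map_mat h (W' * U) *\<^sub>v G"
    using U UW'(2) vecs by (simp add: map_mat_mult_mult_vec)
  also have "\<dots> = G"
    using UW' vecs by (simp add: mat_hom_one)
  finally show "map_mat h (mat_inv V) *\<^sub>v B = G"
    using V by simp
qed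

section \<open>Coordinate matrices and codeword entries\<close>

lemma coord_mat_eqI:
  assumes M: "M \<in> carrier_mat (dim_vec B) (dim_vec v)"
    and cols: "\<And>j. j < dim_vec v \<Longrightarrow> comb B (col M j) = v $ j"
    and inj: "inj_on (comb B) (carrier_vec (dim_vec B))"
  shows "coord_mat h B v = M"
proof -
  \<comment> \<open>Read column by column, the equation defining the coordinate matrix says that
    each column holds the coordinates of one entry of \<open>v\<close>; injectivity then gives
    uniqueness.\<close>
  have row_mult: "B \<cdot>\<^sub>r map_mat h A = vec (dim_vec v) (\<lambda>j. comb B (col A j))"
    if "A \<in> carrier_mat (dim_vec B) (dim_vec v)" for A
    using that
    by (intro eq_vecI) (auto simp: row_mult_def comb_def intro!: comm_scalar_prod[of _ "dim_vec B"])
  show ?thesis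
    unfolding coord_mat_def
  proof (rule the_equality, intro conjI)
    show "B \<cdot>\<^sub>r map_mat h M = v"
      unfolding row_mult[OF M] using cols by (intro eq_vecI) auto
    fix A assume *: "A \<in> carrier_mat (dim_vec B) (dim_vec v) \<and> B \<cdot>\<^sub>r map_mat h A = v"
    then have A: "A \<in> carrier_mat (dim_vec B) (dim_vec v)"
      by (rule conjunct1)
    have eq: "vec (dim_vec v) (\<lambda>j. comb B (col A j)) = v"
      using row_mult[OF A, symmetric] conjunct2[OF *] by (rule trans)
    show "A = M"
    proof (rule mat_col_eqI)
      fix j assume "j < dim_col M"
      then have j: "j < dim_vec v" using M by simp
      then have "comb B (col A j) = comb B (col M j)"
        using arg_cong[OF eq, of "\<lambda>u. u $ j"] cols[OF j] by simp
      then show "col A j = col M j"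
        using A M j by (intro inj_onD[OF inj]) auto
    qed (use A M in auto)
  qed (rule M)
qed

lemma gabidulin_codeword_index:
  assumes "u \<in> carrier_vec k" and "j < dim_vec \<beta>"
  shows "(u \<cdot>\<^sub>r gabidulin_gen CARD('q) k \<beta>) $ j = lin_eval u (\<beta> $ j)"
  using assms
  by (simp add: row_mult_def gabidulin_gen_def lin_eval_def scalar_prod_def atLeast0LessThan)

text \<open>\<open>\<B>\<^sub>\<gamma>\<^sup>T\<close> is a common eigenvector of the matrices \<open>\<^bold>A(\<alpha>)\<close>, with eigenvalue \<open>\<alpha>\<close>.\<close>

lemma A_gen_eigen:
  assumes p: "lead_coeff p = 1" and N: "degree p = N" and root: "poly (map_poly h p) \<gamma> = 0"
  shows "map_mat h (A_gen p) *\<^sub>v gamma_basis N \<gamma> = \<gamma> \<cdot>\<^sub>v gamma_basis N \<gamma>"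
proof (rule eq_vecI)
  fix r assume "r < dim_vec (\<gamma> \<cdot>\<^sub>v gamma_basis N \<gamma>)"
  then have r: "r < N" by (simp add: gamma_basis_def)
  have "(map_mat h (A_gen p) *\<^sub>v gamma_basis N \<gamma>) $ r =
      (\<Sum>c<N. h (A_gen p $$ (r, c)) * \<gamma> ^ (N - 1 - c))"
    using r N by (simp add: A_gen_def gamma_basis_def scalar_prod_def atLeast0LessThan)
  also have "\<dots> = \<gamma> * \<gamma> ^ (N - 1 - r)"
  \<comment> \<open>The first row rewrites \<open>\<gamma> ^ N\<close> by means of \<open>p\<close>;
    every other row picks the preceding entry of the basis, which is the next higher power of
    \<gamma>.\<close>
  proof (cases "r = 0")
    case True
    have "(\<Sum>c<N. h (A_gen p $$ (r, c)) * \<gamma> ^ (N - 1 - c)) =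
        (\<Sum>c<N. - (h (poly.coeff p (N - Suc c)) * \<gamma> ^ (N - Suc c)))"
      using True r N by (intro sum.cong) (auto simp: A_gen_def hom_uminus)
    also have "\<dots> = - (\<Sum>i<N. h (poly.coeff p i) * \<gamma> ^ i)"
      \<comment> \<open>The basis lists the powers in descending order, so the sum is
        reversed.\<close>
      by (subst sum.nat_diff_reindex) (simp add: sum_negf)
    also have "\<dots> = \<gamma> ^ N"
    proof -
      have "0 = (\<Sum>i\<le>N. h (poly.coeff p i) * \<gamma> ^ i)"
        using root N by (simp add: poly_altdef)
      also have "\<dots> = (\<Sum>i<N. h (poly.coeff p i) * \<gamma> ^ i) + \<gamma> ^ N"
        using p N by (simp flip: lessThan_Suc_atMost)
      finally show ?thesis
        by (simp add: eq_neg_iff_add_eq_0 add.commute neg_eq_iff_add_eq_0)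
    qed
    finally show ?thesis
      using True r by (simp flip: power_Suc)
  next
    case False
    have "(\<Sum>c<N. h (A_gen p $$ (r, c)) * \<gamma> ^ (N - 1 - c)) =
        (\<Sum>c<N. if c = r - 1 then \<gamma> ^ (N - 1 - c) else 0)"
      using False r N by (intro sum.cong) (auto simp: A_gen_def)
    also have "\<dots> = \<gamma> ^ (N - 1 - (r - 1))"
      using r by simp
    also have "N - 1 - (r - 1) = Suc (N - 1 - r)"
      using False r by simp
    finally show ?thesis
      by simp
  qed
  finally show "(map_mat h (A_gen p) *\<^sub>v gamma_basis N \<gamma>) $ r = (\<gamma> \<cdot>\<^sub>v gamma_basis N \<gamma>) $ r"
    using r by (simp add: gamma_basis_def)
qed (use N in \<open>simp add: A_gen_def gamma_basis_def\<close>)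

text \<open>Each power \<open>A_gen p ^\<^sub>m i\<close> has eigenvalue \<open>\<gamma> ^ i\<close>
  on the same vector, so combining them with the coordinates of \<alpha> gives the eigenvalue
  \<alpha>.\<close>

lemma A_of_eigen:
  assumes p: "irreducible p" "lead_coeff p = 1" and N: "degree p = N"
    and root: "poly (map_poly h p) \<gamma> = 0" and card: "CARD('e) = CARD('q) ^ N"
  shows "map_mat h (A_of h p \<gamma> \<alpha>) *\<^sub>v gamma_basis N \<gamma> = \<alpha> \<cdot>\<^sub>v gamma_basis N \<gamma>"
proof -
  let ?G = "gamma_basis N \<gamma>"
  \<comment> \<open>The ascending order of powers, which \<open>power_coords\<close> uses;
    \<open>?G\<close> has the descending one.\<close>
  let ?P = "vec N (\<lambda>i. \<gamma> ^ i)"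
  have G: "?G \<in> carrier_vec N"
    by (simp add: gamma_basis_def)
  have "A_gen p \<in> carrier_mat N N"
    using N by (simp add: A_gen_def)
  then have Ai: "A_gen p ^\<^sub>m i \<in> carrier_mat N N"
    and pow_eigen: "map_mat h (A_gen p ^\<^sub>m i) *\<^sub>v ?G = \<gamma> ^ i \<cdot>\<^sub>v ?G" for i
    using eigen_pow[OF _ G A_gen_eigen[OF p(2) N root]] by simp_all
  have combP: "comb ?P a = (\<Sum>i<N. h (a $ i) * \<gamma> ^ i)" if "a \<in> carrier_vec N" for a
    using that by (simp add: comb_eq_sum)
  have "inj_on (comb ?P) (carrier_vec (dim_vec ?P))"
    unfolding inj_on_comb_iff
  proof (intro ballI impI)
    fix a :: "'q vec" assume a: "a \<in> carrier_vec (dim_vec ?P)" "comb ?P a = 0"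
    then have "(\<Sum>i<N. h (a $ i) * \<gamma> ^ i) = 0"
      using combP[of a] by simp
    then have "a $ i = 0" if "i < N" for i
      using powers_independent[OF p(1) root, of "\<lambda>i. a $ i" i] N that by simp
    then show "a = 0\<^sub>v (dim_vec ?P)"
      using a(1) by (intro eq_vecI) simp_all
  qed
  then have bij: "bij_betw (comb ?P) (carrier_vec N) UNIV"
    using bij_betw_comb[of ?P] card by simp
  then obtain a where a: "a \<in> carrier_vec N" "comb ?P a = \<alpha>"
    by (metis UNIV_I bij_betw_def imageE)
  have "power_coords h N \<gamma> \<alpha> = a"
    unfolding power_coords_def
  proof (rule the_equality)
    show "a \<in> carrier_vec N \<and> (\<Sum>i<N. h (a $ i) * \<gamma> ^ i) = \<alpha>"
      using a combP[OF a(1)] by simp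
    fix b assume b: "b \<in> carrier_vec N \<and> (\<Sum>i<N. h (b $ i) * \<gamma> ^ i) = \<alpha>"
    then have "comb ?P b = comb ?P a"
      using a(2) combP[of b] by simp
    then show "b = a"
      using bij a(1) b by (auto simp: bij_betw_def dest: inj_onD)
  qed
  then have A: "A_of h p \<gamma> \<alpha> = mat N N (\<lambda>rc. \<Sum>i<N. a $ i * (A_gen p ^\<^sub>m i) $$ rc)"
    using N by (simp add: A_of_def)
  show ?thesis
  proof (rule eq_vecI)
    fix r assume "r < dim_vec (\<alpha> \<cdot>\<^sub>v ?G)"
    then have r: "r < N" using G by simp
    have "(map_mat h (A_of h p \<gamma> \<alpha>) *\<^sub>v ?G) $ r =
        (\<Sum>c<N. h (\<Sum>i<N. a $ i * (A_gen p ^\<^sub>m i) $$ (r, c)) * ?G $ c)"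
      using r G by (simp add: A scalar_prod_def atLeast0LessThan)
    also have "\<dots> = (\<Sum>c<N. \<Sum>i<N. h (a $ i) * (h ((A_gen p ^\<^sub>m i) $$ (r, c)) * ?G $ c))"
      by (simp add: hom_sum hom_mult sum_distrib_right mult.assoc)
    also have "\<dots> = (\<Sum>i<N. \<Sum>c<N. h (a $ i) * (h ((A_gen p ^\<^sub>m i) $$ (r, c)) * ?G $ c))"
      by (rule sum.swap)
    also have "\<dots> = (\<Sum>i<N. h (a $ i) * (\<Sum>c<N. h ((A_gen p ^\<^sub>m i) $$ (r, c)) * ?G $ c))"
      by (simp only: sum_distrib_left)
    also have "\<dots> = (\<Sum>i<N. h (a $ i) * (map_mat h (A_gen p ^\<^sub>m i) *\<^sub>v ?G) $ r)"
      by (simp only: map_mat_mult_vec_index[OF Ai G r])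
    also have "\<dots> = (\<Sum>i<N. h (a $ i) * (\<gamma> ^ i * ?G $ r))"
      using r G by (simp add: pow_eigen)
    also have "\<dots> = \<alpha> * ?G $ r"
      using combP[OF a(1), unfolded a(2)] by (simp add: sum_distrib_right mult.assoc)
    finally show "(map_mat h (A_of h p \<gamma> \<alpha>) *\<^sub>v ?G) $ r = (\<alpha> \<cdot>\<^sub>v ?G) $ r"
      using r G by simp
  qed (use A G in simp)
qed

text \<open>Reversing the order of summation reduces injectivity to the independence of the powers
  of \<gamma>; counting gives the rest.\<close>

lemma bij_betw_comb_gamma_basis:
  assumes "irreducible p" and N: "degree p = N"
    and root: "poly (map_poly h p) \<gamma> = 0" and card: "CARD('e) = CARD('q) ^ N"
  shows "bij_betw (comb (gamma_basis N \<gamma>)) (carrier_vec N) UNIV"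
proof -
  let ?G = "gamma_basis N \<gamma>"
  have dim: "dim_vec ?G = N"
    by (simp add: gamma_basis_def)
  have "inj_on (comb ?G) (carrier_vec (dim_vec ?G))"
    unfolding inj_on_comb_iff
  proof (intro ballI impI)
    fix x :: "'q vec" assume x: "x \<in> carrier_vec (dim_vec ?G)" "comb ?G x = 0"
    have "comb ?G x = (\<Sum>i<N. h (x $ i) * \<gamma> ^ (N - Suc i))"
      using x dim by (simp add: comb_eq_sum) (simp add: gamma_basis_def)
    also have "\<dots> = (\<Sum>i<N. h (x $ (N - Suc i)) * \<gamma> ^ i)"
      by (subst sum.nat_diff_reindex[symmetric]) (auto intro!: sum.cong)
    finally have "(\<Sum>i<degree p. h (x $ (N - Suc i)) * \<gamma> ^ i) = 0"
      unfolding x(2) N by (rule sym)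
    note * = powers_independent[OF assms(1) root this, unfolded N]
    have "x $ i = 0" if "i < N" for i
      using *[of "N - Suc i"] that by (simp add: Suc_diff_Suc)
    then show "x = 0\<^sub>v (dim_vec ?G)"
      using x(1) dim by (intro eq_vecI) auto
  qed
  then show ?thesis
    using bij_betw_comb[of ?G] card dim by simp
qed

end

section \<open>Gabidulin codes\<close>

text \<open>The basis property of \<open>B\<close> and the independence of \<open>\<beta>\<close>
  enter as bijectivity and injectivity of \<open>comb\<close>. The matrices built from \<gamma> are
  left out here and come in later as an abstract family.\<close>

locale induced_gabidulin_code = finite_field_extension h
  for h :: "'q :: {field, finite} \<Rightarrow> 'e :: {field, finite}" +
  fixes B \<beta> :: "'e vec" and N n k :: nat
  assumes card_ext: "CARD('e) = CARD('q) ^ N"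
    and k_pos: "1 \<le> k" and k_le_n: "k \<le> n"
    and dim_B: "dim_vec B = N" and dim_\<beta>: "dim_vec \<beta> = n"
    and bij_B: "bij_betw (comb B) (carrier_vec N) UNIV"
    and inj_\<beta>: "inj_on (comb \<beta>) (carrier_vec n)"
begin

definition codeword :: "'e vec \<Rightarrow> 'q mat"
  where "codeword u = coord_mat h B (u \<cdot>\<^sub>r gabidulin_gen CARD('q) k \<beta>)"

lemma codeword_eqI:
  assumes "u \<in> carrier_vec k" and "M \<in> carrier_mat N n"
    and "\<And>j. j < n \<Longrightarrow> comb B (col M j) = lin_eval u (\<beta> $ j)"
  shows "codeword u = M"
proof -
  have "dim_vec (u \<cdot>\<^sub>r gabidulin_gen CARD('q) k \<beta>) = n"
    by (simp add: row_mult_def gabidulin_gen_def dim_\<beta>)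
  then show ?thesis
    unfolding codeword_def
    using assms bij_B gabidulin_codeword_index[OF assms(1)]
    by (intro coord_mat_eqI) (simp_all add: dim_B dim_\<beta> bij_betw_def)
qed

lemma
  assumes "u \<in> carrier_vec k"
  shows codeword_carrier: "codeword u \<in> carrier_mat N n"
    and comb_col_codeword: "j < n \<Longrightarrow> comb B (col (codeword u) j) = lin_eval u (\<beta> $ j)"
proof -
  have "\<exists>x\<in>carrier_vec N. comb B x = y" for y
    using bij_B by (metis UNIV_I bij_betw_def imageE)
  then obtain x where x: "\<And>y. x y \<in> carrier_vec N" "\<And>y. comb B (x y) = y"
    by metis
  \<comment> \<open>An explicit solution, with the coordinates of the values as columns, shows that
    the description in \<open>coord_mat\<close> is satisfiable.\<close>
  define M where "M = mat_of_cols N (map (\<lambda>j. x (lin_eval u (\<beta> $ j))) [0..<n])"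
  have M: "M \<in> carrier_mat N n"
    unfolding M_def using mat_of_cols_carrier(1)[of N "map (\<lambda>j. x (lin_eval u (\<beta> $ j))) [0..<n]"]
    by simp
  have col: "comb B (col M j) = lin_eval u (\<beta> $ j)" if "j < n" for j
    using that x by (simp add: M_def)
  have "codeword u = M"
    using assms M col by (rule codeword_eqI)
  then show "codeword u \<in> carrier_mat N n"
    and "j < n \<Longrightarrow> comb B (col (codeword u) j) = lin_eval u (\<beta> $ j)"
    using M col by simp_all
qed

lemma codeword_minus:
  assumes "u \<in> carrier_vec k" and "u' \<in> carrier_vec k"
  shows "codeword (u - u') = codeword u - codeword u'"
proof (rule codeword_eqI)
  show "codeword u - codeword u' \<in> carrier_mat N n"
    using codeword_carrier assms by (intro minus_carrier_mat)
  fix j assume j: "j < n"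
  have "col (codeword u - codeword u') j = col (codeword u) j - col (codeword u') j"
    using codeword_carrier[OF assms(1)] codeword_carrier[OF assms(2)] j by (intro eq_vecI) auto
  then show "comb B (col (codeword u - codeword u') j) = lin_eval (u - u') (\<beta> $ j)"
    using assms j comb_col_codeword codeword_carrier[OF assms(1)] codeword_carrier[OF assms(2)]
    by (simp add: comb_minus lin_eval_minus dim_B)
qed (use assms in simp)

text \<open>By linearity of \<open>lin_eval u\<close>, a combination of the columns represents the
  value at the same combination of the entries of \<open>\<beta>\<close>. The codeword is thus the
  matrix of \<open>lin_eval u\<close> on the span of \<open>\<beta>\<close>.\<close>

lemma comb_codeword_mult_vec:
  assumes u: "u \<in> carrier_vec k" and x: "x \<in> carrier_vec n"
  shows "comb B (codeword u *\<^sub>v x) = lin_eval u (comb \<beta> x)"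
proof -
  let ?M = "map_mat h (codeword u)"
  note M = codeword_carrier[OF u]
  have hM: "?M \<in> carrier_mat N n"
    using M by simp
  have "comb B (codeword u *\<^sub>v x) = (?M *\<^sub>v map_vec h x) \<bullet> B"
    using M x by (simp add: comb_def mult_mat_vec_hom[of _ N n])
  also have "\<dots> = map_vec h x \<bullet> (transpose_mat ?M *\<^sub>v B)"
    using transpose_vec_mult_scalar[of "transpose_mat ?M" n N B "map_vec h x"] hM x
      carrier_vecI[OF dim_B] by simp
  also have "\<dots> = (\<Sum>j<n. h (x $ j) * (transpose_mat ?M *\<^sub>v B) $ j)"
    using hM x by (simp add: scalar_prod_def atLeast0LessThan)
  also have "\<dots> = (\<Sum>j<n. h (x $ j) * lin_eval u (\<beta> $ j))"
  proof (rule sum.cong[OF refl])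
    fix j assume "j \<in> {..<n}"
    then have j: "j < n" by simp
    have "(transpose_mat ?M *\<^sub>v B) $ j = comb B (col (codeword u) j)"
      using j M by (simp add: comb_def)
    then show "h (x $ j) * (transpose_mat ?M *\<^sub>v B) $ j = h (x $ j) * lin_eval u (\<beta> $ j)"
      using comb_col_codeword[OF u j] by simp
  qed
  also have "\<dots> = lin_eval u (\<Sum>j<n. h (x $ j) * \<beta> $ j)"
    by (rule lin_eval_sum[symmetric])
  also have "(\<Sum>j<n. h (x $ j) * \<beta> $ j) = comb \<beta> x"
    using x dim_\<beta> by (simp add: comb_eq_sum)
  finally show ?thesis .
qed

lemma rank_codeword_ge:
  assumes u: "u \<in> carrier_vec k" "u \<noteq> 0\<^sub>v k"
  shows "n - k + 1 \<le> vec_space.rank N (codeword u)"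
proof -
  let ?K = "{x \<in> carrier_vec n. codeword u *\<^sub>v x = 0\<^sub>v N}"
  have "comb B (0\<^sub>v N) = 0"
    by (simp add: comb_eq_sum dim_B)
  then have "comb \<beta> ` ?K \<subseteq> {y. lin_eval u y = 0}"
    using comb_codeword_mult_vec[OF u(1)] by fastforce
  \<comment> \<open>Independence of \<open>\<beta>\<close> makes the map from the kernel to the
    roots injective.\<close>
  then have "card ?K \<le> card {y. lin_eval u y = 0}"
    by (intro card_inj_on_le[of "comb \<beta>"] inj_on_subset[OF inj_\<beta>]) auto
  also have "\<dots> \<le> CARD('q) ^ (k - 1)"
    using u by (rule card_roots_lin_eval)
  finally have "CARD('q) ^ n \<le> CARD('q) ^ vec_space.rank N (codeword u) * CARD('q) ^ (k - 1)"
    using card_carrier_vec_le_rank_kernel[OF codeword_carrier[OF u(1)]] mult_le_mono2 order_trans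
    by blast
  then have "CARD('q) ^ n \<le> CARD('q) ^ (vec_space.rank N (codeword u) + (k - 1))"
    by (simp only: power_add)
  then have "n \<le> vec_space.rank N (codeword u) + (k - 1)"
    using card_base_gt_1 by (rule power_le_imp_le_exp[rotated])
  then show ?thesis
    using k_pos k_le_n by linarith
qed

lemma minus_vec_neq_0:
  fixes u u' :: "'e vec"
  assumes "u \<in> carrier_vec k" and "u' \<in> carrier_vec k" and "u \<noteq> u'"
  shows "u - u' \<noteq> 0\<^sub>v k"
proof
  assume eq: "u - u' = 0\<^sub>v k"
  have "u $ i = u' $ i" if "i < k" for i
    using arg_cong[OF eq, of "\<lambda>w. w $ i"] assms that by simp
  then show False
    using assms by (metis carrier_vecD eq_vecI)
qed

text \<open>Two messages with the same codeword would give a nonzero message whose codeword has rank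
  0, below the positive bound \<open>n - k + 1\<close>.\<close>

lemma inj_on_codeword: "inj_on codeword (carrier_vec k)"
proof (rule inj_onI, rule ccontr)
  fix u u' assume u: "u \<in> carrier_vec k" "u' \<in> carrier_vec k" "codeword u = codeword u'" "u \<noteq> u'"
  have w: "u - u' \<in> carrier_vec k"
    using u by simp
  note M = codeword_carrier[OF u(1)]
  have "codeword (u - u') = codeword u - codeword u"
    using codeword_minus[OF u(1,2)] u(3) by simp
  then have "col (codeword (u - u')) j = 0\<^sub>v N" if "j < n" for j
    using that M by (intro eq_vecI) auto
  then have "vec_space.rank N (codeword (u - u')) = 0"
    using rank_le_card_nonzero_cols[OF codeword_carrier[OF w], of "{}"] by simp
  then show False
    using rank_codeword_ge[OF w minus_vec_neq_0] u by simp
qed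

text \<open>
  There are more messages than values of the first \<open>k - 1\<close> evaluations, so two codewords
  share their first \<open>k - 1\<close> columns.
\<close>

lemma rank_codeword_minus_attained:
  obtains u u' where "u \<in> carrier_vec k" "u' \<in> carrier_vec k" "u \<noteq> u'"
    "vec_space.rank N (codeword u - codeword u') \<le> n - k + 1"
proof -
  let ?f = "\<lambda>u. vec (k - 1) (\<lambda>j. lin_eval u (\<beta> $ j))"
  have "1 < CARD('e)"
    using card_mono[of UNIV "{0, 1 :: 'e}"] by simp
  then have "CARD('e) ^ (k - 1) < CARD('e) ^ k"
    using k_pos by (intro power_strict_increasing) auto
  then have "card (carrier_vec (k - 1) :: 'e vec set) < card (carrier_vec k :: 'e vec set)"
    by (simp only: card_carrier_vec)
  moreover have "card (?f ` carrier_vec k) \<le> card (carrier_vec (k - 1) :: 'e vec set)"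
    by (rule card_mono) auto
  ultimately have "\<not> inj_on ?f (carrier_vec k)"
    by (intro pigeonhole) linarith
  then obtain u u' where u: "u \<in> carrier_vec k" "u' \<in> carrier_vec k" "u \<noteq> u'" "?f u = ?f u'"
    by (auto simp: inj_on_def)
  have w: "u - u' \<in> carrier_vec k"
    using u by simp
  \<comment> \<open>These are the first \<open>k - 1\<close> columns; the excluded range has
    \<open>n - (k - 1) = n - k + 1\<close> members.\<close>
  have "col (codeword (u - u')) j = 0\<^sub>v N" if j: "j < n" "j \<notin> {k - 1..<n}" for j
  proof (rule inj_onD)
    show "inj_on (comb B) (carrier_vec N)"
      using bij_B by (simp add: bij_betw_def)
    have "lin_eval u (\<beta> $ j) = lin_eval u' (\<beta> $ j)"
      using arg_cong[OF u(4), of "\<lambda>v. v $ j"] j by simp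
    then have "comb B (col (codeword (u - u')) j) = 0"
      using comb_col_codeword[OF w j(1)] u by (simp add: lin_eval_minus)
    then show "comb B (col (codeword (u - u')) j) = comb B (0\<^sub>v N)"
      by (simp add: comb_eq_sum dim_B)
  qed (use codeword_carrier[OF w] j in auto)
  then have "vec_space.rank N (codeword (u - u')) \<le> card {k - 1..<n}"
    by (intro rank_le_card_nonzero_cols[OF codeword_carrier[OF w]]) simp_all
  then have "vec_space.rank N (codeword u - codeword u') \<le> n - k + 1"
    using codeword_minus[OF u(1,2)] k_pos k_le_n by simp
  then show ?thesis
    using that u by blast
qed

lemma induced_code_eq:
  "induced_code h B (gabidulin_linear_code CARD('q) k \<beta>) = codeword ` carrier_vec k"
  by (auto simp: induced_code_def gabidulin_linear_code_def codeword_def)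

lemma rank_metric_code_induced_code:
  "rank_metric_code N n (CARD('q) ^ (N * k)) (n - k + 1)
    (induced_code h B (gabidulin_linear_code CARD('q) k \<beta>))"
  unfolding rank_metric_code_def induced_code_eq
proof (intro conjI)
  let ?C = "codeword ` carrier_vec k"
  show "?C \<subseteq> carrier_mat N n"
    using codeword_carrier by auto
  show "card ?C = CARD('q) ^ (N * k)"
    using card_image[OF inj_on_codeword] by (simp only: card_carrier_vec card_ext power_mult)
  let ?R = "{vec_space.rank N (X - Y) | X Y. X \<in> ?C \<and> Y \<in> ?C \<and> X \<noteq> Y}"
  have lower: "n - k + 1 \<le> vec_space.rank N (codeword u - codeword u')"
    if "u \<in> carrier_vec k" "u' \<in> carrier_vec k" "u \<noteq> u'" for u u'
    using rank_codeword_ge[of "u - u'"] minus_vec_neq_0[OF that] codeword_minus that by simp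
  have "Min ?R = n - k + 1"
  proof (rule Min_eqI)
    have "?R \<subseteq> (\<lambda>(X, Y). vec_space.rank N (X - Y)) ` (?C \<times> ?C)"
      by auto
    then show "finite ?R"
      by (rule finite_subset) simp
    show "n - k + 1 \<le> r" if "r \<in> ?R" for r
      using that lower by blast
    obtain u u' where u: "u \<in> carrier_vec k" "u' \<in> carrier_vec k" "u \<noteq> u'"
      "vec_space.rank N (codeword u - codeword u') \<le> n - k + 1"
      by (rule rank_codeword_minus_attained)
    then have "n - k + 1 = vec_space.rank N (codeword u - codeword u')"
      using lower by (intro order_antisym)
    \<comment> \<open>The minimum runs over pairs of distinct matrices, so distinct messages alone
      do not suffice.\<close>
    moreover have "codeword u \<noteq> codeword u'"
      using inj_on_codeword u by (auto dest: inj_onD)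
    ultimately show "n - k + 1 \<in> ?R"
      using u(1,2) by blast
  qed
  then show "min_rank_distance N ?C = n - k + 1"
    by (simp only: min_rank_distance_def)
qed

text \<open>Only the eigenvector equation for \<open>B\<close> matters: under it, a vector
  polynomial yields the codeword whose message entries are represented by its coefficient
  rows.\<close>

lemma induced_code_eq_Ldag_evals:
  assumes X: "\<And>\<alpha>. X \<alpha> \<in> carrier_mat N N"
    and eigen: "\<And>\<alpha>. map_mat h (X \<alpha>) *\<^sub>v B = \<alpha> \<cdot>\<^sub>v B"
  shows "induced_code h B (gabidulin_linear_code CARD('q) k \<beta>) =
    {mat_of_cols N (map (\<lambda>j. Ldag_eval CARD('q) L (X (\<beta> $ j))) [0..<n]) | L. L \<in> Ldag N k}"
    (is "_ = {?M L | L. _}")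
proof -
  have B: "B \<in> carrier_vec N"
    using dim_B by (rule carrier_vecI)
  have codeword: "codeword (vec k (\<lambda>i. comb B (L ! i))) = ?M L" if L: "L \<in> Ldag N k" for L
  proof (rule codeword_eqI)
    show "?M L \<in> carrier_mat N n"
      using mat_of_cols_carrier(1)[of N "map (\<lambda>j. Ldag_eval CARD('q) L (X (\<beta> $ j))) [0..<n]"] by simp
    fix j assume j: "j < n"
    have "Ldag_eval CARD('q) L (X (\<beta> $ j)) \<in> carrier_vec N"
      using X[of "\<beta> $ j"] by (simp add: Ldag_eval_def)
    then have "col (?M L) j = Ldag_eval CARD('q) L (X (\<beta> $ j))"
      using j by simp
    then show "comb B (col (?M L) j) = lin_eval (vec k (\<lambda>i. comb B (L ! i))) (\<beta> $ j)"
      using comb_Ldag_eval[OF X B eigen L] by simp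
  qed simp
  \<comment> \<open>Every message arises: take the coordinates of its entries as coefficient
    rows.\<close>
  have "\<exists>L\<in>Ldag N k. u = vec k (\<lambda>i. comb B (L ! i))" if u: "u \<in> carrier_vec k" for u
  proof -
    have "\<exists>x\<in>carrier_vec N. comb B x = y" for y
      using bij_B by (metis UNIV_I bij_betw_def imageE)
    then obtain x where x: "\<And>y. x y \<in> carrier_vec N" "\<And>y. comb B (x y) = y"
      by metis
    let ?L = "map (\<lambda>i. x (u $ i)) [0..<k]"
    have "?L \<in> Ldag N k"
      using x by (auto simp: Ldag_def)
    moreover have "u = vec k (\<lambda>i. comb B (?L ! i))"
      using u x by (intro eq_vecI) auto
    ultimately show ?thesis
      by blast
  qed
  then have "carrier_vec k = (\<lambda>L. vec k (\<lambda>i. comb B (L ! i))) ` Ldag N k"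
    by auto
  then have "codeword ` carrier_vec k = (\<lambda>L. codeword (vec k (\<lambda>i. comb B (L ! i)))) ` Ldag N k"
    by (simp only: image_image)
  also have "\<dots> = ?M ` Ldag N k"
    using codeword by (rule image_cong[OF refl])
  finally show ?thesis
    by (simp only: induced_code_eq image_def Bex_def conj_commute)
qed

end

section \<open>The code as evaluations at conjugated multiplication matrices\<close>

theorem proposition10:
  fixes h :: "'q :: {field, finite} \<Rightarrow> 'e :: {field, finite}"
    and p :: "'q poly"
    and \<gamma> :: 'e
    and \<beta> B :: "'e vec"
    and q k n N :: nat
    and V :: "'q mat"
  assumes "field_hom h"
    and "CARD('q) = q"
    and "CARD('e) = q ^ N"
    and "1 \<le> k" and "k \<le> n" and "n \<le> N"
    and "irreducible p" and "lead_coeff p = 1" and "degree p = N"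
    and "poly (map_poly h p) \<gamma> = 0"
    and "dim_vec \<beta> = n" and "lin_indep_family h \<beta>"
    and "dim_vec B = N" and "ordered_basis h B"
    and "V = basis_change h B (gamma_basis N \<gamma>)"
  shows "induced_code h B (gabidulin_linear_code q k \<beta>) =
      {mat_of_cols N
         (map (\<lambda>j. Ldag_eval q L (V * A_of h p \<gamma> (\<beta> $ j) * mat_inv V)) [0..<n])
       | L. L \<in> Ldag N k}
      \<and> rank_metric_code N n (q ^ (N * k)) (n - k + 1)
            (induced_code h B (gabidulin_linear_code q k \<beta>))"
proof -
  interpret finite_field_extension h
    using assms(1) by (rule finite_field_extension.intro)
  have card: "CARD('e) = CARD('q) ^ N"
    using assms(2,3) by simp
  have bij_B: "bij_betw (comb B) (carrier_vec N) UNIV"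
    using bij_betw_comb[of B] inj_on_comb_if_lin_indep_family[of B] card assms(13,14)
    by (simp add: ordered_basis_def)
  have inj_\<beta>: "inj_on (comb \<beta>) (carrier_vec n)"
    using inj_on_comb_if_lin_indep_family[OF assms(12)] assms(11) by simp
  interpret induced_gabidulin_code h B \<beta> N n k
    using card assms(4,5,11,13) bij_B inj_\<beta> by unfold_locales
  let ?G = "gamma_basis N \<gamma>"
  have G: "dim_vec ?G = N"
    by (simp add: gamma_basis_def)
  note V = basis_change_properties[OF dim_B G bij_B
      bij_betw_comb_gamma_basis[OF assms(7,9,10) card], folded assms(15)]
  have A: "A_of h p \<gamma> \<alpha> \<in> carrier_mat N N" for \<alpha>
    using assms(9) by (simp add: A_of_def)
  \<comment> \<open>The inverse of \<open>V\<close> carries \<open>B\<close> to the basis of powers,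
    the middle factor scales that by \<alpha>, and \<open>V\<close> carries the result back.\<close>
  have eigen: "map_mat h (V * A_of h p \<gamma> \<alpha> * mat_inv V) *\<^sub>v B = \<alpha> \<cdot>\<^sub>v B" for \<alpha>
  proof -
    have vecs: "B \<in> carrier_vec N" "?G \<in> carrier_vec N"
      using dim_B G by (auto intro: carrier_vecI)
    have VA: "V * A_of h p \<gamma> \<alpha> \<in> carrier_mat N N"
      using V(1) A by (rule mult_carrier_mat)
    have "map_mat h (V * A_of h p \<gamma> \<alpha> * mat_inv V) *\<^sub>v B =
        map_mat h (V * A_of h p \<gamma> \<alpha>) *\<^sub>v ?G"
      by (simp only: map_mat_mult_mult_vec[OF VA V(2) vecs(1)] V(4))
    also have "\<dots> = map_mat h V *\<^sub>v (\<alpha> \<cdot>\<^sub>v ?G)"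
      by (simp only: map_mat_mult_mult_vec[OF V(1) A vecs(2)] A_of_eigen[OF assms(7-10) card])
    also have "\<dots> = \<alpha> \<cdot>\<^sub>v B"
      using V(1,3) vecs by (simp add: mult_mat_vec[of _ N N])
    finally show ?thesis .
  qed
  have "V * A_of h p \<gamma> \<alpha> * mat_inv V \<in> carrier_mat N N" for \<alpha>
    using V(1,2) A[of \<alpha>] by simp
  from induced_code_eq_Ldag_evals[of "\<lambda>\<alpha>. V * A_of h p \<gamma> \<alpha> * mat_inv V", OF this eigen]
    rank_metric_code_induced_code
  show ?thesis
    by (simp only: assms(2))
qed

end
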